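(* There is no algorithm in the read/write streams model that uses only one stream, $\log^{O(1)} n$ bits of internal memory and $\log^{O(1)} n$ passes and that, given a string $s$ of length $n$ and a number $\ell$, correctly checks whether $\ell$ is the minimum period of $s$.
   Context: Read/write streams model: an algorithm has an internal memory of $m$ bits and access to a fixed number of streams (tapes); each stream is a sequence of cells accessed sequentially by a read/write head; a pass is one sequential sweep over a stream. The input is initially on the stream. The minimum period of $s$ is the least $\ell\ge1$ with $s[i]=s[i+\ell]$ for all $1\le i\le n-\ell$. *)

theory Defs
  imports Complex_Main "HOL-Library.Landau_Symbols" "HOL-Library.Cardinality"
begin

definition is_period :: "'a list \<Rightarrow> nat \<Rightarrow> bool" where
  "is_period s l \<longleftrightarrow> 1 \<le> l \<and> (\<forall>i. i + l < length s \<longrightarrow> s ! i = s ! (i + l))"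

definition min_period :: "'a list \<Rightarrow> nat" where
  "min_period s = (LEAST l. is_period s l)"

(* Besides characters of the input string and digits of the input number, a cell may hold
   a symbol of an additional finite working alphabet 'w. *)
datatype ('a, 'w) cell = Blank | Digit bool | Char 'a | Work 'w

datatype direction = Leftward | Rightward

datatype 'c action =
    Halt bool
  | Move 'c "bool list" direction

(* Move x u d overwrites the current cell with x, replaces the internal memory by u and
   moves the head one cell in direction d.  An algorithm has a single stream.  The same
   algorithm serves all input lengths; the number of memory bits used is measured along
   the run, and internal computation between two cell accesses is unrestricted. *)
record 'c algorithm =
  start_memory :: "bool list"
  act :: "bool list \<Rightarrow> 'c \<Rightarrow> 'c action"

record 'c config =
  memory :: "bool list"
  stream :: "int \<Rightarrow> 'c"
  head :: int
  heading :: direction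
  passes :: nat

(* A pass is a maximal run of moves in one direction, so every change of direction starts
   a new pass.  A halting configuration is a fixed point. *)
definition step :: "'c algorithm \<Rightarrow> 'c config \<Rightarrow> 'c config" where
  "step A c =
    (case act A (memory c) (stream c (head c)) of
       Halt b \<Rightarrow> c
     | Move x u d \<Rightarrow>
         \<lparr> memory = u,
           stream = (stream c)(head c := x),
           head = (case d of Leftward \<Rightarrow> head c - 1 | Rightward \<Rightarrow> head c + 1),
           heading = d,
           passes = (if d = heading c then passes c else passes c + 1) \<rparr>)"

(* least significant digit first *)
fun binary :: "nat \<Rightarrow> bool list" where
  "binary l = (if l = 0 then [] else odd l # binary (l div 2))"

declare binary.simps [simp del]

definition input :: "'a list \<Rightarrow> nat \<Rightarrow> ('a, 'w) cell list" where
  "input s l = map Digit (binary l) @ map Char s"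

(* The head starts on the first input cell; all cells on either side of the input are blank. *)
definition initial :: "('a, 'w) cell algorithm \<Rightarrow> 'a list \<Rightarrow> nat \<Rightarrow> ('a, 'w) cell config" where
  "initial A s l =
    (let w = input s l in
     \<lparr> memory = start_memory A,
       stream = (\<lambda>i. if 0 \<le> i \<and> i < int (length w) then w ! nat i else Blank),
       head = 0,
       heading = Rightward,
       passes = 1 \<rparr>)"

definition config_at :: "('a, 'w) cell algorithm \<Rightarrow> 'a list \<Rightarrow> nat \<Rightarrow> nat \<Rightarrow> ('a, 'w) cell config" where
  "config_at A s l t = (step A ^^ t) (initial A s l)"

definition answers :: "('a, 'w) cell algorithm \<Rightarrow> 'a list \<Rightarrow> nat \<Rightarrow> bool \<Rightarrow> bool" where
  "answers A s l b \<longleftrightarrow>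
    (\<exists>t. let c = config_at A s l t in act A (memory c) (stream c (head c)) = Halt b)"

definition valid_input :: "'a list \<Rightarrow> nat \<Rightarrow> bool" where
  "valid_input s l \<longleftrightarrow> 1 \<le> l \<and> l \<le> length s"

definition memory_bounded :: "('a, 'w) cell algorithm \<Rightarrow> (nat \<Rightarrow> nat) \<Rightarrow> bool" where
  "memory_bounded A m \<longleftrightarrow>
    (\<forall>s l t. valid_input s l \<longrightarrow> length (memory (config_at A s l t)) \<le> m (length s))"

definition passes_bounded :: "('a, 'w) cell algorithm \<Rightarrow> (nat \<Rightarrow> nat) \<Rightarrow> bool" where
  "passes_bounded A p \<longleftrightarrow>
    (\<forall>s l t. valid_input s l \<longrightarrow> passes (config_at A s l t) \<le> p (length s))"

definition checks_min_period :: "('a, 'w) cell algorithm \<Rightarrow> bool" where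
  "checks_min_period A \<longleftrightarrow>
    (\<forall>s l. valid_input s l \<longrightarrow> answers A s l (l = min_period s))"

definition polylog :: "(nat \<Rightarrow> nat) \<Rightarrow> bool" where
  "polylog f \<longleftrightarrow> (\<exists>k. (\<lambda>n. real (f n)) \<in> O(\<lambda>n. log 2 (real n) ^ k))"

end

theory Submission
  imports Defs "HOL-Library.Sublist" "HOL-Real_Asymp.Real_Asymp"
begin

text \<open>
  A crossing-sequence argument. Within one pass the head crosses a given boundary between two cells
  at most once, so the memory contents at the crossings of the boundary take only polylogarithmically
  many bits. If the runs on \<open>u @ u\<close> and \<open>v @ v\<close> have the same crossing sequence at the middle, then
  the run on \<open>u @ v\<close> behaves like the first on the left and like the second on the right, and so
  it gives the same answer. All \<open>2 ^ k\<close> words \<open>u = a ^ (k + 1) b y b\<close> with \<open>y\<close> a word of length \<open>k\<close>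
  over \<open>{a, b}\<close> give squares \<open>u @ u\<close> of minimum period \<open>2 * k + 3\<close>, while \<open>u @ v\<close> has this
  period only if \<open>u = v\<close>.
\<close>

section \<open>Crossing sequences\<close>

lemma head_step:
  "step A c = c \<or> \<bar>head (step A c) - head c\<bar> = 1"
  by (auto simp: step_def split: action.splits direction.splits)

lemma stream_step_other:
  "i \<noteq> head c \<Longrightarrow> stream (step A c) i = stream c i"
  by (auto simp: step_def split: action.splits direction.splits)

text \<open>Each entry is the memory carried into the side just entered. Directions are not
  recorded, since crossings of the boundary of \<open>L\<close> alternate between leaving and
  entering. A set of cells instead of a position lets the two sides be exchanged by
  complement.\<close>

primrec crossings :: "int set \<Rightarrow> 'c algorithm \<Rightarrow> 'c config \<Rightarrow> nat \<Rightarrow> bool list list" where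
  "crossings L A c 0 = []"
| "crossings L A c (Suc t) =
    (if head ((step A ^^ t) c) \<in> L \<longleftrightarrow> head ((step A ^^ Suc t) c) \<in> L
     then crossings L A c t
     else crossings L A c t @ [memory ((step A ^^ Suc t) c)])"

lemma crossings_Compl: "crossings (- L) A c t = crossings L A c t"
  by (induction t) auto

lemma prefix_crossings:
  assumes "t \<le> t'"
  shows "prefix (crossings L A c t) (crossings L A c t')"
  using assms by (induction rule: dec_induct) (auto intro: prefix_order.trans)

text \<open>The sequence grows by at most one entry per step, so no prefix is skipped.\<close>

lemma prefix_crossingsD:
  assumes "prefix zs (crossings L A c t)"
  shows "zs \<in> range (crossings L A c)"
  using assms
proof (induction t)
  case 0
  then show ?case by (auto intro: range_eqI[of _ _ 0])
next
  case (Suc t)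
  show ?case
  proof (cases "zs = crossings L A c (Suc t)")
    case True
    show ?thesis unfolding True by (rule rangeI)
  next
    case False
    with Suc.prems have "prefix zs (crossings L A c t)"
      by (auto split: if_splits)
    then show ?thesis by (rule Suc.IH)
  qed
qed

lemma set_crossings:
  assumes "\<And>t. P (memory ((step A ^^ t) c))"
  shows "\<forall>x \<in> set (crossings L A c t). P x"
  by (induction t) (use assms[of "Suc _"] in auto)

lemma length_crossings_le_passes:
  assumes "heading c = Rightward" "head c < B" "passes c = 1"
  shows "length (crossings {..<B} A c t) \<le> passes ((step A ^^ t) c)"
proof -
  \<comment> \<open>The extra summand is 1 exactly when the heading points towards the boundary,
    that is, when the current pass can still cross it. A crossing uses up this unit; only a
    reversal, paid for by a new pass, restores it.\<close>
  have "length (crossings {..<B} A c t) +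
      of_bool (heading ((step A ^^ t) c) = Rightward \<longleftrightarrow> head ((step A ^^ t) c) < B)
    \<le> passes ((step A ^^ t) c)"
  proof (induction t)
    case 0
    then show ?case using assms by simp
  next
    case (Suc t)
    define x where "x = (step A ^^ t) c"
    have "length (crossings {..<B} A c t) + of_bool (heading x = Rightward \<longleftrightarrow> head x < B)
      \<le> passes x"
      using Suc by (simp only: x_def)
    moreover define y where "y = step A x"
    have "length (crossings {..<B} A c (Suc t)) =
        length (crossings {..<B} A c t) + of_bool ((head x < B) \<noteq> (head y < B))"
      by (simp add: x_def y_def)
    moreover have "y = x \<or> head y = (case heading y of Leftward \<Rightarrow> head x - 1 | Rightward \<Rightarrow> head x + 1) \<and>
        passes y = passes x + of_bool (heading y \<noteq> heading x)"
      unfolding y_def step_def by (cases "act A (memory x) (stream x (head x))") auto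
    ultimately have "length (crossings {..<B} A c (Suc t)) + of_bool (heading y = Rightward \<longleftrightarrow> head y < B)
      \<le> passes y"
      by (cases "heading x"; cases "heading y"; cases "head x < B"; cases "head y < B") auto
    moreover have "(step A ^^ Suc t) c = y"
      by (simp add: x_def y_def)
    ultimately show ?case by (simp only:)
  qed
  then show ?thesis by linarith
qed

section \<open>Halting runs\<close>

lemma step_halted:
  assumes "act A (memory c) (stream c (head c)) = Halt b"
  shows "(step A ^^ t) c = c"
  by (induction t) (use assms in \<open>auto simp: step_def\<close>)

lemma run_halted:
  assumes "act A (memory ((step A ^^ T) c)) (stream ((step A ^^ T) c) (head ((step A ^^ T) c))) = Halt b"
    and "T \<le> t"
  shows "(step A ^^ t) c = (step A ^^ T) c"
proof -
  have "(step A ^^ t) c = (step A ^^ (t - T)) ((step A ^^ T) c)"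
    using assms(2) by (simp flip: funpow_add[unfolded o_def, THEN fun_cong])
  then show ?thesis using step_halted[OF assms(1)] by simp
qed

lemma crossings_halted:
  assumes "act A (memory ((step A ^^ T) c)) (stream ((step A ^^ T) c) (head ((step A ^^ T) c))) = Halt b"
    and "T \<le> t"
  shows "crossings L A c t = crossings L A c T"
  using assms(2)
proof (induction rule: dec_induct)
  case (step t)
  moreover have "(step A ^^ Suc t) c = (step A ^^ t) c"
    using run_halted[OF assms(1)] step by (metis le_SucI)
  ultimately show ?case by simp
qed simp

text \<open>Gluing compares runs by the set of crossing sequences they attain. For a halting run one
  finite list determines this set, which makes counting possible.\<close>

lemma range_crossings_halted:
  assumes "act A (memory ((step A ^^ T) c)) (stream ((step A ^^ T) c) (head ((step A ^^ T) c))) = Halt b"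
  shows "range (crossings L A c) = {zs. prefix zs (crossings L A c T)}"
proof -
  have "prefix (crossings L A c t) (crossings L A c T)" for t
    using prefix_crossings[of t T] crossings_halted[OF assms, of t L]
    by (cases "t \<le> T") auto
  then show ?thesis by (auto dest: prefix_crossingsD)
qed

section \<open>Gluing runs\<close>

text \<open>Both half-lines have this property. It makes the cell entered on leaving
  \<open>L\<close> the same in every run, so crossing sequences need not store positions.\<close>

definition one_exit :: "int set \<Rightarrow> bool" where
  "one_exit L \<longleftrightarrow>
    (\<exists>e. \<forall>h h'. h \<in> L \<longrightarrow> h' \<notin> L \<longrightarrow> \<bar>h' - h\<bar> = 1 \<longrightarrow> h' = e)"

lemma one_exit_lessThan: "one_exit {..<B}" "one_exit (- {..<B})"
  unfolding one_exit_def by (rule exI[of _ B] exI[of _ "B - 1"]; auto)+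

text \<open>A change of the crossing sequence forces the head out of \<open>L\<close>. Up to the
  first exit it writes only inside \<open>L\<close>, so the cells outside keep their
  contents.\<close>

lemma next_crossing:
  assumes "head ((step A ^^ j) c) \<in> L"
    and "crossings L A c j' \<noteq> crossings L A c j" "j \<le> j'"
  obtains i where "j \<le> i" "i < j'"
    "head ((step A ^^ i) c) \<in> L" "head ((step A ^^ Suc i) c) \<notin> L"
    "crossings L A c i = crossings L A c j"
    "\<And>z. z \<notin> L \<Longrightarrow> stream ((step A ^^ Suc i) c) z = stream ((step A ^^ j) c) z"
proof -
  have "\<exists>i. j \<le> i \<and> i < j' \<and> head ((step A ^^ i) c) \<in> L \<and> head ((step A ^^ Suc i) c) \<notin> L \<and>
      crossings L A c i = crossings L A c j \<and>
      (\<forall>z. z \<notin> L \<longrightarrow> stream ((step A ^^ Suc i) c) z = stream ((step A ^^ j) c) z)"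
  proof (rule ccontr)
    assume none: "\<not> ?thesis"
    have "t \<le> j' \<longrightarrow> head ((step A ^^ t) c) \<in> L \<and> crossings L A c t = crossings L A c j \<and>
        (\<forall>z. z \<notin> L \<longrightarrow> stream ((step A ^^ t) c) z = stream ((step A ^^ j) c) z)"
      if "j \<le> t" for t
      using that
    proof (induction rule: dec_induct)
      case base
      then show ?case using assms(1) by simp
    next
      case (step t)
      show ?case
      proof
        assume "Suc t \<le> j'"
        then have t: "t < j'" "head ((step A ^^ t) c) \<in> L" "crossings L A c t = crossings L A c j"
          "\<And>z. z \<notin> L \<Longrightarrow> stream ((step A ^^ t) c) z = stream ((step A ^^ j) c) z"
          using step by auto
        have str: "stream ((step A ^^ Suc t) c) z = stream ((step A ^^ j) c) z" if "z \<notin> L" for z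
          using stream_step_other[of z "(step A ^^ t) c" A] t(2) t(4)[OF that] that by auto
        then have "head ((step A ^^ Suc t) c) \<in> L"
          using none t step.hyps by blast
        then show "head ((step A ^^ Suc t) c) \<in> L \<and>
            crossings L A c (Suc t) = crossings L A c j \<and>
            (\<forall>z. z \<notin> L \<longrightarrow> stream ((step A ^^ Suc t) c) z = stream ((step A ^^ j) c) z)"
          using t str by simp
      qed
    qed
    then show False using assms by blast
  qed
  then show ?thesis using that by blast
qed

text \<open>The heads of \<open>x\<close> and \<open>y\<close> must be on the same side, and the run
  on that side supplies head and memory. Heading and passes are left free because \<open>act\<close>
  does not see them.\<close>

definition glued :: "int set \<Rightarrow> 'c config \<Rightarrow> 'c config \<Rightarrow> 'c config \<Rightarrow> bool" where
  "glued L x y z \<longleftrightarrow>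
    (head x \<in> L \<longleftrightarrow> head y \<in> L) \<and>
    (\<forall>i. stream z i = (if i \<in> L then stream x i else stream y i)) \<and>
    head z = (if head x \<in> L then head x else head y) \<and>
    memory z = (if head x \<in> L then memory x else memory y)"

lemma glued_Compl: "glued (- L) y x z \<longleftrightarrow> glued L x y z"
  by (auto simp: glued_def)

text \<open>The times \<open>i\<close> and \<open>j\<close> are independent, since the two runs may
  spend different numbers of steps on either side; equal crossing sequences synchronise
  them.\<close>

definition glued_run ::
    "int set \<Rightarrow> 'c algorithm \<Rightarrow> 'c config \<Rightarrow> 'c config \<Rightarrow> 'c config \<Rightarrow> bool" where
  "glued_run L A x y z \<longleftrightarrow>
    (\<exists>i j. crossings L A x i = crossings L A y j \<and>
      glued L ((step A ^^ i) x) ((step A ^^ j) y) z)"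

lemma glued_run_Compl: "glued_run (- L) A y x z \<longleftrightarrow> glued_run L A x y z"
  unfolding glued_run_def glued_Compl crossings_Compl by metis

text \<open>Inside \<open>L\<close> the glued configuration copies \<open>x\<close> while
  \<open>y\<close> waits. When \<open>x\<close> leaves \<open>L\<close>, \<open>y\<close> is
  advanced to its own next exit, which by \<open>sub\<close> exists and hands over the same
  memory.\<close>

lemma glued_run_step_inside:
  assumes "one_exit L"
    and sub: "range (crossings L A x) \<subseteq> range (crossings L A y)"
    and "glued_run L A x y z" and inside: "head z \<in> L"
  shows "glued_run L A x y (step A z)"
proof -
  from assms(3) obtain i j where cr: "crossings L A x i = crossings L A y j"
    and gl: "glued L ((step A ^^ i) x) ((step A ^^ j) y) z"
    unfolding glued_run_def by blast
  define x' where "x' = (step A ^^ i) x"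
  define y' where "y' = (step A ^^ j) y"
  have x': "head x' \<in> L" "head z = head x'" "memory z = memory x'"
      and y': "head y' \<in> L"
      and str: "\<And>k. stream z k = (if k \<in> L then stream x' k else stream y' k)"
    using gl inside unfolding glued_def x'_def y'_def by (auto split: if_splits)
  have same: "head (step A z) = head (step A x')" "memory (step A z) = memory (step A x')"
    "\<And>k. stream (step A z) k = (if k \<in> L then stream (step A x') k else stream y' k)"
    using x' str by (auto simp: step_def split: action.splits direction.splits)
  show ?thesis
  proof (cases "head (step A x') \<in> L")
    case True
    then have "crossings L A x (Suc i) = crossings L A y j"
      using x' cr by (simp add: x'_def)
    moreover have "glued L ((step A ^^ Suc i) x) ((step A ^^ j) y) (step A z)"
      using True y' same by (auto simp: glued_def x'_def y'_def)
    ultimately show ?thesis unfolding glued_run_def by blast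
  next
    case False
    then have cx: "crossings L A x (Suc i) = crossings L A y j @ [memory (step A x')]"
      using x' cr by (simp add: x'_def)
    have "crossings L A x (Suc i) \<in> range (crossings L A y)"
      using sub by blast
    \<comment> \<open>The run from \<open>y\<close> also attains the sequence with one more entry,
      so it must cross again after time \<open>j\<close>.\<close>
    then obtain j' where "crossings L A x (Suc i) = crossings L A y j'"
      by (rule rangeE)
    with cx have j': "crossings L A y j' = crossings L A y j @ [memory (step A x')]"
      by (simp only:)
    then have "\<not> prefix (crossings L A y j') (crossings L A y j)"
      by (auto dest: prefix_length_le)
    then have "j \<le> j'"
      using prefix_crossings nat_le_linear by metis
    have "crossings L A y j' \<noteq> crossings L A y j"
      using j' by simp
    obtain q where q: "j \<le> q" "q < j'"
      "head ((step A ^^ q) y) \<in> L" "head ((step A ^^ Suc q) y) \<notin> L"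
      "crossings L A y q = crossings L A y j"
      "\<And>z. z \<notin> L \<Longrightarrow> stream ((step A ^^ Suc q) y) z = stream ((step A ^^ j) y) z"
      by (rule next_crossing[OF y'[unfolded y'_def] \<open>crossings L A y j' \<noteq> _\<close> \<open>j \<le> j'\<close>]) (rule that)
    have cy: "crossings L A y (Suc q) = crossings L A y j @ [memory ((step A ^^ Suc q) y)]"
      using q by simp
    \<comment> \<open>Both lists extend the same list by exactly one entry, so being a prefix forces
      these entries to agree.\<close>
    have "prefix (crossings L A y (Suc q)) (crossings L A y j')"
      using q by (intro prefix_crossings) simp
    then have mem: "memory ((step A ^^ Suc q) y) = memory (step A x')"
      using cy j' by simp
    have "\<bar>head (step A x') - head x'\<bar> = 1"
      using head_step[of A x'] x' False by auto
    moreover have "\<bar>head ((step A ^^ Suc q) y) - head ((step A ^^ q) y)\<bar> = 1"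
      using head_step[of A "(step A ^^ q) y"] q by auto
    ultimately have hd: "head ((step A ^^ Suc q) y) = head (step A x')"
      using assms(1) False x'(1) q(3,4) unfolding one_exit_def by metis
    have "glued L ((step A ^^ Suc i) x) ((step A ^^ Suc q) y) (step A z)"
      unfolding glued_def using same mem hd False q(6)
      by (simp add: x'_def y'_def)
    moreover have "crossings L A x (Suc i) = crossings L A y (Suc q)"
      using cx cy mem by simp
    ultimately show ?thesis unfolding glued_run_def by blast
  qed
qed

lemma glued_run_step:
  assumes "one_exit L" "one_exit (- L)"
    and "range (crossings L A x) = range (crossings L A y)"
    and "glued_run L A x y z"
  shows "glued_run L A x y (step A z)"
proof (cases "head z \<in> L")
  case True
  then show ?thesis using glued_run_step_inside assms by blast
next
  case False
  \<comment> \<open>Outside \<open>L\<close> the roles of the two runs are exchanged by passing to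
    the complement.\<close>
  then have "glued_run (- L) A y x (step A z)"
    using assms by (intro glued_run_step_inside) (auto simp: glued_run_Compl crossings_Compl[abs_def])
  then show ?thesis by (simp add: glued_run_Compl)
qed

lemma glued_run_funpow:
  assumes "one_exit L" "one_exit (- L)"
    and "range (crossings L A x) = range (crossings L A y)"
    and "glued L x y z"
  shows "glued_run L A x y ((step A ^^ t) z)"
proof (induction t)
  case 0
  have "glued_run L A x y z"
    unfolding glued_run_def using assms(4) by (intro exI[of _ 0]) simp
  then show ?case by simp
next
  case (Suc t)
  then show ?case using glued_run_step assms by simp
qed

text \<open>When the glued run halts, its memory and scanned cell are those of one of the two
  original runs at some time, so that run halts there with the same answer.\<close>

lemma answers_glued:
  assumes range: "range (crossings {..<B} A (initial A s l)) = range (crossings {..<B} A (initial A s' l'))"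
    and "glued {..<B} (initial A s l) (initial A s' l') (initial A s'' l'')"
    and "answers A s'' l'' b"
  shows "answers A s l b \<or> answers A s' l' b"
proof -
  from assms(3) obtain t where t: "let c = config_at A s'' l'' t in
      act A (memory c) (stream c (head c)) = Halt b"
    unfolding answers_def by blast
  have "glued_run {..<B} A (initial A s l) (initial A s' l') (config_at A s'' l'' t)"
    unfolding config_at_def using assms by (intro glued_run_funpow one_exit_lessThan)
  then obtain i j where "glued {..<B} (config_at A s l i) (config_at A s' l' j) (config_at A s'' l'' t)"
    unfolding glued_run_def config_at_def by blast
  with t show ?thesis
    unfolding answers_def glued_def by (auto simp: Let_def split: if_splits)
qed

lemma answers_unique:
  assumes "answers A s l b" "answers A s l b'"
  shows "b = b'"
proof -
  obtain t t' where t: "act A (memory (config_at A s l t))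
        (stream (config_at A s l t) (head (config_at A s l t))) = Halt b"
    and t': "act A (memory (config_at A s l t'))
        (stream (config_at A s l t') (head (config_at A s l t'))) = Halt b'"
    using assms by (auto simp: answers_def Let_def)
  have "config_at A s l t = config_at A s l t'"
    using run_halted[of A t "initial A s l" b t'] run_halted[of A t' "initial A s l" b' t] t t'
    unfolding config_at_def by (metis nat_le_linear)
  with t t' show ?thesis by simp
qed

text \<open>The common number \<open>l\<close> occupies the same cells in all three inputs, and
  \<open>B\<close> is the first cell after the first word.\<close>

lemma glued_initial:
  fixes A :: "('a, 'w) cell algorithm"
  assumes "length u = length v" "length u' = length v'"
    and "B = int (length (binary l) + length u)"
  shows "glued {..<B} (initial A (u @ u') l) (initial A (v @ v') l) (initial A (u @ v') l)"
  using assms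
  by (auto simp: glued_def initial_def input_def Let_def nth_append)

section \<open>Periods of squares\<close>

lemma is_period_min_period: "s \<noteq> [] \<Longrightarrow> is_period s (min_period s)"
  unfolding min_period_def
  by (rule LeastI[of _ "length s"]) (auto simp: is_period_def Suc_le_eq)

lemma is_period_append_same_length:
  assumes "is_period (u @ v) (length u)" "length u = length v"
  shows "u = v"
proof (rule nth_equalityI)
  fix i assume "i < length u"
  then show "u ! i = v ! i"
    using assms by (auto simp: is_period_def nth_append dest!: spec[of _ i])
qed (fact assms(2))

text \<open>A shorter period would shift one of the two fixed letters \<open>b\<close> in the first
  copy of \<open>u\<close> into the leading block of \<open>a\<close>: the one at index
  \<open>k + 1\<close> if \<open>p \<le> k + 1\<close>, the one at index \<open>2 * k + 2\<close>
  otherwise.\<close>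

lemma min_period_square:
  assumes "a \<noteq> b" "length ys = k" and u: "u = replicate (Suc k) a @ b # ys @ [b]"
  shows "min_period (u @ u) = length u"
  unfolding min_period_def
proof (rule Least_equality)
  show "is_period (u @ u) (length u)"
  proof -
    have "1 \<le> length u" by (simp add: u)
    then show ?thesis by (auto simp: is_period_def nth_append)
  qed
next
  fix p assume p: "is_period (u @ u) p"
  have len: "length u = 2 * k + 3"
    using assms by simp
  have a: "(u @ u) ! i = a" if "i \<le> k" for i
    using that by (simp add: u nth_append del: replicate.simps)
  have b: "(u @ u) ! (k + 1) = b" "(u @ u) ! (2 * k + 2) = b"
    using assms(2) by (simp_all add: u nth_append nth_Cons' del: replicate.simps)
  show "length u \<le> p"
  proof (rule ccontr)
    assume "\<not> length u \<le> p"
    then consider "p \<le> k + 1" | "k + 2 \<le> p" "p \<le> 2 * k + 2"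
      using len by linarith
    then show False
    proof cases
      case 1
      then have "(u @ u) ! (k + 1 - p) = (u @ u) ! (k + 1)"
        using p len by (auto simp: is_period_def dest!: spec[of _ "k + 1 - p"])
      moreover have "k + 1 - p \<le> k"
        using p by (auto simp: is_period_def)
      ultimately show False using a b(1) assms(1) by metis
    next
      case 2
      then have "(u @ u) ! (2 * k + 2 - p) = (u @ u) ! (2 * k + 2)"
        using p len by (auto simp: is_period_def dest!: spec[of _ "2 * k + 2 - p"])
      then show False using a[of "2 * k + 2 - p"] b 2 assms(1) by simp
    qed
  qed
qed

section \<open>Counting\<close>

text \<open>A crude geometric sum, used both for the words of bounded length and for the lists of
  such words.\<close>

lemma sum_power_le:
  fixes a :: nat
  assumes "2 \<le> a"
  shows "(\<Sum>i\<le>n. a ^ i) \<le> a ^ Suc n"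
proof (induction n)
  case (Suc n)
  have "(\<Sum>i\<le>Suc n. a ^ i) \<le> 2 * a ^ Suc n"
    using Suc by simp
  also have "\<dots> \<le> a * a ^ Suc n"
    using assms by (intro mult_right_mono) auto
  finally show ?case by simp
qed (use assms in simp)

lemma card_lists_bool_lists_le:
  "finite {zs :: bool list list. length zs \<le> p \<and> (\<forall>x \<in> set zs. length x \<le> m)}" (is "finite ?Z")
  "card {zs :: bool list list. length zs \<le> p \<and> (\<forall>x \<in> set zs. length x \<le> m)} \<le> 2 ^ (Suc m * Suc p)"
proof -
  define W where "W = {x :: bool list. set x \<subseteq> UNIV \<and> length x \<le> m}"
  have W: "finite W" "card W \<le> 2 ^ Suc m"
    using finite_lists_length_le[of "UNIV :: bool set" m] card_lists_length_le[of "UNIV :: bool set" m]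
      sum_power_le[of 2 m]
    unfolding W_def by (simp_all only: finite card_UNIV_bool)
  have Z: "?Z = {zs. set zs \<subseteq> W \<and> length zs \<le> p}"
    by (auto simp: W_def)
  show "finite ?Z"
    unfolding Z by (rule finite_lists_length_le[OF W(1)])
  have "card ?Z = (\<Sum>i\<le>p. card W ^ i)"
    unfolding Z by (rule card_lists_length_le[OF W(1)])
  also have "\<dots> \<le> (\<Sum>i\<le>p. (2 ^ Suc m) ^ i)"
    by (intro sum_mono power_mono W) auto
  also have "\<dots> \<le> (2 ^ Suc m) ^ Suc p"
    by (rule sum_power_le) auto
  finally show "card ?Z \<le> 2 ^ (Suc m * Suc p)"
    by (simp only: power_mult)
qed

lemma polylog_Suc_mult_smallo:
  assumes "polylog m" "polylog p"
  shows "(\<lambda>n. real (Suc (m n) * Suc (p n))) \<in> o(\<lambda>n. real n)"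
proof -
  have Suc_bigo: "(\<lambda>n. real (Suc (f n))) \<in> O(\<lambda>n. log 2 (real n) ^ k)"
    if "(\<lambda>n. real (f n)) \<in> O(\<lambda>n. log 2 (real n) ^ k)" for f k
  proof -
    \<comment> \<open>Once the logarithm is at least 1, so are all its powers, and they absorb the
      added constant 1.\<close>
    have "\<forall>\<^sub>F n in sequentially. 1 \<le> log 2 (real n)"
      by real_asymp
    then have "\<forall>\<^sub>F n in sequentially. norm (1 :: real) \<le> 1 * norm (log 2 (real n) ^ k)"
      by eventually_elim (simp add: one_le_power power_abs)
    then have "(\<lambda>n. 1 :: real) \<in> O(\<lambda>n. log 2 (real n) ^ k)"
      by (rule bigoI)
    then have "(\<lambda>n. 1 + real (f n)) \<in> O(\<lambda>n. log 2 (real n) ^ k)"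
      using that by (rule sum_in_bigo)
    then show ?thesis by simp
  qed
  obtain k k' where "(\<lambda>n. real (m n)) \<in> O(\<lambda>n. log 2 (real n) ^ k)"
    "(\<lambda>n. real (p n)) \<in> O(\<lambda>n. log 2 (real n) ^ k')"
    using assms unfolding polylog_def by blast
  then have "(\<lambda>n. real (Suc (m n)) * real (Suc (p n))) \<in>
      O(\<lambda>n. log 2 (real n) ^ k * log 2 (real n) ^ k')"
    by (intro landau_o.big.mult Suc_bigo)
  also have "(\<lambda>n. log 2 (real n) ^ k * log 2 (real n) ^ k') \<in> o(\<lambda>n. real n)"
    by real_asymp
  finally show ?thesis by (simp only: of_nat_mult)
qed

section \<open>The lower bound on memory and passes\<close>

text \<open>By pigeonhole: the \<open>2 ^ k\<close> squares must have pairwise distinct final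
  crossing sequences, each a list of at most \<open>p n\<close> words of at most \<open>m n\<close>
  bits.\<close>

lemma crossing_bound:
  fixes A :: "('a, 'w) cell algorithm"
  assumes mem: "memory_bounded A m" and pas: "passes_bounded A p" and chk: "checks_min_period A"
    and ab: "(a :: 'a) \<noteq> b"
  shows "k \<le> Suc (m (4 * k + 6)) * Suc (p (4 * k + 6))"
proof -
  \<comment> \<open>Every input consists of two words of length \<open>N\<close>, so its length is
    \<open>n = 2 * N\<close>. The same number \<open>N\<close> is asked about each time, and
    \<open>B\<close> separates the two words.\<close>
  define n where "n = 4 * k + 6"
  define N where "N = 2 * k + 3"
  define B where "B = int (length (binary N) + N)"
  define Y where "Y = {ys. set ys \<subseteq> {a, b} \<and> length ys = k}"
  define u where "u = (\<lambda>ys. replicate (Suc k) a @ b # ys @ [b])"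
  define Z where "Z = {zs :: bool list list. length zs \<le> p n \<and> (\<forall>x \<in> set zs. length x \<le> m n)}"
  have len: "length (u ys) = N" if "ys \<in> Y" for ys
    using that by (simp add: u_def Y_def N_def)
  have valid: "valid_input (u ys @ u ys') N" "length (u ys @ u ys') = n" if "ys \<in> Y" "ys' \<in> Y" for ys ys'
    using that len by (auto simp: valid_input_def N_def n_def)
  have period: "N = min_period (u ys @ u ys') \<longleftrightarrow> ys = ys'" if "ys \<in> Y" "ys' \<in> Y" for ys ys'
  proof
    assume "N = min_period (u ys @ u ys')"
    then have "is_period (u ys @ u ys') (length (u ys))"
      using is_period_min_period[of "u ys @ u ys'"] len that by (simp add: u_def)
    then have "u ys = u ys'"
      using is_period_append_same_length len that by metis
    then show "ys = ys'" by (simp add: u_def)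
  next
    assume "ys = ys'"
    then show "N = min_period (u ys @ u ys')"
      using min_period_square[OF ab, of ys k "u ys"] that len by (auto simp: u_def Y_def)
  qed
  have ans: "answers A (u ys @ u ys') N (ys = ys')" if "ys \<in> Y" "ys' \<in> Y" for ys ys'
  proof -
    have "answers A (u ys @ u ys') N (N = min_period (u ys @ u ys'))"
      using chk valid(1)[OF that] unfolding checks_min_period_def by blast
    then show ?thesis by (simp only: period[OF that])
  qed
  define I where "I = (\<lambda>ys. initial A (u ys @ u ys) N)"
  \<comment> \<open>Each run on a square gives an answer, hence halts, and so has a final crossing
    sequence.\<close>
  have "\<exists>T. range (crossings {..<B} A (I ys)) = {zs. prefix zs (crossings {..<B} A (I ys) T)}"
    if "ys \<in> Y" for ys
    using ans[OF that that] range_crossings_halted[of A _ "I ys" True "{..<B}"]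
    by (auto simp: answers_def config_at_def I_def Let_def)
  then obtain T where T: "\<And>ys. ys \<in> Y \<Longrightarrow>
      range (crossings {..<B} A (I ys)) = {zs. prefix zs (crossings {..<B} A (I ys) (T ys))}"
    by metis
  define X where "X = (\<lambda>ys. crossings {..<B} A (I ys) (T ys))"
  have "inj_on X Y"
  proof (rule inj_onI, rule ccontr)
    fix ys ys' assume Y: "ys \<in> Y" "ys' \<in> Y" and X: "X ys = X ys'" and "ys \<noteq> ys'"
    \<comment> \<open>The mixed word lacks the period \<open>N\<close>. If the sequences coincided,
      gluing would carry this negative answer over to one of the squares, both of which are
      accepted.\<close>
    then have "answers A (u ys @ u ys') N False"
      using ans by metis
    moreover have "range (crossings {..<B} A (I ys)) = range (crossings {..<B} A (I ys'))"
      using T Y X by (simp add: X_def)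
    moreover have "glued {..<B} (I ys) (I ys') (initial A (u ys @ u ys') N)"
      unfolding I_def by (rule glued_initial) (simp_all add: len Y B_def)
    ultimately have "answers A (u ys @ u ys) N False \<or> answers A (u ys' @ u ys') N False"
      unfolding I_def by (intro answers_glued)
    then show False
      using ans Y answers_unique by (metis (full_types))
  qed
  moreover have "X ` Y \<subseteq> Z"
  proof
    fix zs assume "zs \<in> X ` Y"
    then obtain ys where ys: "ys \<in> Y" "zs = X ys" by blast
    have "length zs \<le> passes ((step A ^^ T ys) (I ys))"
      unfolding ys(2) X_def
      by (rule length_crossings_le_passes) (auto simp: I_def initial_def Let_def B_def N_def)
    also have "\<dots> \<le> p n"
      using pas valid[OF ys(1) ys(1)] unfolding passes_bounded_def config_at_def I_def by metis
    finally have "length zs \<le> p n" .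
    moreover have "\<forall>x \<in> set zs. length x \<le> m n"
      unfolding ys(2) X_def
      using mem valid[OF ys(1) ys(1)] unfolding memory_bounded_def config_at_def I_def
      by (intro set_crossings) metis
    ultimately show "zs \<in> Z" by (simp add: Z_def)
  qed
  ultimately have "card Y \<le> card Z"
    by (rule card_inj_on_le) (unfold Z_def, rule card_lists_bool_lists_le(1))
  also have "\<dots> \<le> 2 ^ (Suc (m n) * Suc (p n))"
    unfolding Z_def by (rule card_lists_bool_lists_le)
  also have "card Y = 2 ^ k"
    using ab by (simp add: Y_def card_lists_length_eq numeral_2_eq_2)
  finally show ?thesis
    unfolding n_def by (rule power_le_imp_le_exp[rotated]) simp
qed

theorem theorem6:
  assumes "CARD('a::finite) \<ge> 2"
  shows "\<not> (\<exists>(A :: ('a, 'w::finite) cell algorithm) m p.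
    polylog m \<and> polylog p \<and> memory_bounded A m \<and> passes_bounded A p \<and> checks_min_period A)"
proof
  assume "\<exists>(A :: ('a, 'w) cell algorithm) m p.
    polylog m \<and> polylog p \<and> memory_bounded A m \<and> passes_bounded A p \<and> checks_min_period A"
  then obtain A :: "('a, 'w) cell algorithm" and m p where polylog: "polylog m" "polylog p"
    and A: "memory_bounded A m" "passes_bounded A p" "checks_min_period A"
    by blast
  obtain a b :: 'a where "a \<noteq> b"
    using assms by (metis card_2_iff' obtain_subset_with_card_n)
  then have bound: "k \<le> Suc (m (4 * k + 6)) * Suc (p (4 * k + 6))" for k
    using crossing_bound[OF A] by blast
  \<comment> \<open>The factor 1/8 turns the bound at \<open>n = 4 * k + 6\<close> into
    \<open>k / 2 + 3 / 4\<close>, which is less than \<open>k\<close> as soon as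
    \<open>k \<ge> 2\<close>.\<close>
  have "\<forall>\<^sub>F n in sequentially. norm (real (Suc (m n) * Suc (p n))) \<le> 1 / 8 * norm (real n)"
    using polylog_Suc_mult_smallo[OF polylog] by (rule landau_o.smallD) simp
  then obtain n0 where n0: "\<And>n. n0 \<le> n \<Longrightarrow>
      norm (real (Suc (m n) * Suc (p n))) \<le> 1 / 8 * norm (real n)"
    unfolding eventually_sequentially by blast
  define k where "k = n0 + 2"
  have "real k \<le> real (Suc (m (4 * k + 6)) * Suc (p (4 * k + 6)))"
    using bound[of k] by (simp only: of_nat_le_iff)
  also have "\<dots> \<le> 1 / 8 * real (4 * k + 6)"
    using n0[of "4 * k + 6"] by (simp add: k_def)
  finally show False by (simp add: k_def)
qed

end
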